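(* If the boundary condition is periodic or the solution has compact support, then the two-dimensional CT scheme given in the context satisfies the energy conservation identity $$\sum_{i,j}\left(\frac12\rho_{ij}^{n}|\bm v_{ij}^{n}|^2+\frac12|\bm B_{ij}^{n}|^2\right)=\sum_{i,j}\left(\frac12\rho_{ij}^{n+1}|\bm v_{ij}^{n+1}|^2+\frac12|\bm B_{ij}^{n+1}|^2\right).$$
   Context: Uniform 2D grid with spacings $\Delta x,\Delta y>0$, time step $\Delta t>0$. Either indices $(i,j)$ are taken periodically and the sums run over one period, or (compact support) the grid is $\mathbb Z^2$ and $\bm B,\bm v$ at both time levels $n,n+1$ vanish outside a finite set of cells. $\bm B_{ij}=(B^x_{ij},B^y_{ij},B^z_{ij})^\top$, $\bm v_{ij}=(v^x_{ij},v^y_{ij},v^z_{ij})^\top\in\mathbb R^3$; $\rho_{ij}^{n+1}=\rho_{ij}^n>0$ (density is unchanged in this step). Set $\bm B_{ij}^{n+\frac12}=\frac12(\bm B_{ij}^n+\bm B_{ij}^{n+1})$, $\bm v_{ij}^{n+\frac12}=\frac12(\bm v_{ij}^n+\bm v_{ij}^{n+1})$, $\mathbf\Omega_{ij}^{n+\frac12}=\bm B_{ij}^{n+\frac12}\times\bm v_{ij}^{n+\frac12}=(\Omega^x,\Omega^y,\Omega^z)_{ij}^{n+\frac12}$. For a grid function $f$ write $D_xf_{ij}=\frac{f_{i+1,j}-f_{i-1,j}}{2\Delta x}$, $D_yf_{ij}=\frac{f_{i,j+1}-f_{i,j-1}}{2\Delta y}$. The (implicit) CT scheme, holding at all $(i,j)$,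 is $$B^{x,n+1}_{ij}=B^{x,n}_{ij}-\Delta t\,D_y\Omega^{z,n+\frac12}_{ij},\quad B^{y,n+1}_{ij}=B^{y,n}_{ij}+\Delta t\,D_x\Omega^{z,n+\frac12}_{ij},$$ $$B^{z,n+1}_{ij}=B^{z,n}_{ij}-\Delta t\,D_x\Omega^{y,n+\frac12}_{ij}+\Delta t\,D_y\Omega^{x,n+\frac12}_{ij},$$ $$\rho_{ij}^n\bm v_{ij}^{n+1}=\rho_{ij}^n\bm v_{ij}^n-\Delta t\,\bm B_{ij}^{n+\frac12}\times\operatorname{curl}\bm B_{ij}^{n+\frac12},\qquad \operatorname{curl}\bm B_{ij}:=\left(D_yB^z_{ij},\ -D_xB^z_{ij},\ D_xB^y_{ij}-D_yB^x_{ij}\right)^\top .$$ *)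

theory Defs
  imports "HOL-Analysis.Analysis"
begin

type_synonym 'a grid = "int \<Rightarrow> int \<Rightarrow> 'a"

definition Dx :: "real \<Rightarrow> real grid \<Rightarrow> real grid" where
  "Dx dx f i j = (f (i + 1) j - f (i - 1) j) / (2 * dx)"

definition Dy :: "real \<Rightarrow> real grid \<Rightarrow> real grid" where
  "Dy dy f i j = (f i (j + 1) - f i (j - 1)) / (2 * dy)"

definition component :: "(real^3) grid \<Rightarrow> 3 \<Rightarrow> real grid" where
  "component F k i j = F i j $ k"

text \<open>All fields are independent of the third coordinate, so no z-derivatives occur.\<close>

definition grid_curl :: "real \<Rightarrow> real \<Rightarrow> (real^3) grid \<Rightarrow> (real^3) grid" where
  "grid_curl dx dy F i j =
     vector [Dy dy (component F 3) i j,
             - Dx dx (component F 3) i j,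
             Dx dx (component F 2) i j - Dy dy (component F 1) i j]"

text \<open>Time-dependent grid functions take the time level as their first argument;
  \<open>midpoint F n\<close> is the value of \<open>F\<close> at level n + 1/2.\<close>

definition midpoint :: "(nat \<Rightarrow> (real^3) grid) \<Rightarrow> nat \<Rightarrow> (real^3) grid" where
  "midpoint F n i j = (1/2) *\<^sub>R (F n i j + F (Suc n) i j)"

definition Omega_mid ::
  "(nat \<Rightarrow> (real^3) grid) \<Rightarrow> (nat \<Rightarrow> (real^3) grid) \<Rightarrow> nat \<Rightarrow> (real^3) grid" where
  "Omega_mid B v n i j = cross3 (midpoint B n i j) (midpoint v n i j)"

text \<open>The density is frozen during this step.\<close>

definition CT_step ::
  "real \<Rightarrow> real \<Rightarrow> real \<Rightarrow> (nat \<Rightarrow> real grid) \<Rightarrow> (nat \<Rightarrow> (real^3) grid) \<Rightarrow> (nat \<Rightarrow> (real^3) grid)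
     \<Rightarrow> nat \<Rightarrow> bool" where
  "CT_step dx dy dt \<rho> B v n \<longleftrightarrow>
     (\<forall>i j.
        \<rho> (Suc n) i j = \<rho> n i j \<and>
        B (Suc n) i j $ 1 = B n i j $ 1 - dt * Dy dy (component (Omega_mid B v n) 3) i j \<and>
        B (Suc n) i j $ 2 = B n i j $ 2 + dt * Dx dx (component (Omega_mid B v n) 3) i j \<and>
        B (Suc n) i j $ 3 = B n i j $ 3 - dt * Dx dx (component (Omega_mid B v n) 2) i j
                                        + dt * Dy dy (component (Omega_mid B v n) 1) i j \<and>
        \<rho> n i j *\<^sub>R v (Suc n) i j =
          \<rho> n i j *\<^sub>R v n i j
          - dt *\<^sub>R cross3 (midpoint B n i j) (grid_curl dx dy (midpoint B n) i j))"

definition periodic_grid :: "int \<Rightarrow> int \<Rightarrow> 'a grid \<Rightarrow> bool" where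
  "periodic_grid Nx Ny f \<longleftrightarrow> (\<forall>i j. f (i + Nx) j = f i j \<and> f i (j + Ny) = f i j)"

definition compact_support_grid :: "'a::zero grid \<Rightarrow> bool" where
  "compact_support_grid f \<longleftrightarrow> finite {(i, j). f i j \<noteq> 0}"

definition cell_energy ::
  "(nat \<Rightarrow> real grid) \<Rightarrow> (nat \<Rightarrow> (real^3) grid) \<Rightarrow> (nat \<Rightarrow> (real^3) grid) \<Rightarrow> nat \<Rightarrow> real grid" where
  "cell_energy \<rho> B v n i j =
     1/2 * \<rho> n i j * (norm (v n i j))\<^sup>2 + 1/2 * (norm (B n i j))\<^sup>2"

end

theory Submission imports Defs begin

text \<open>Pairing the momentum equation with the midpoint velocity and the induction equation with the
  midpoint field \<open>b\<close> gives \<open>dt * (curl b \<bullet> \<Omega> + b \<bullet> curl \<Omega>)\<close> as the energy change of a cell, because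
  \<open>(b \<times> curl b) \<bullet> u = - curl b \<bullet> (b \<times> u)\<close>. Each product \<open>f * D g + D f * g\<close> with the central
  difference \<open>D\<close> is the difference of a flux at neighbouring cells, so the sum over a box telescopes
  to boundary terms, which cancel (periodic case) or vanish (compact support).\<close>

text \<open>Lives on the face between cells \<open>i - 1\<close> and \<open>i\<close> and is
  symmetric in \<open>f\<close> and \<open>g\<close>. Only mixed products occur, because a central
  difference skips its own cell.\<close>

definition flux_x :: "real grid \<Rightarrow> real grid \<Rightarrow> real grid" where
  "flux_x f g i j = f i j * g (i - 1) j + f (i - 1) j * g i j"

definition flux_y :: "real grid \<Rightarrow> real grid \<Rightarrow> real grid" where
  "flux_y f g i j = f i j * g i (j - 1) + f i (j - 1) * g i j"

lemma Dx_product: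
  "Dx h f i j * g i j + f i j * Dx h g i j = (flux_x f g (i + 1) j - flux_x f g i j) / (2 * h)"
  by (simp add: Dx_def flux_x_def flip: add_divide_distrib) (simp add: algebra_simps)

lemma Dy_product:
  "Dy h f i j * g i j + f i j * Dy h g i j = (flux_y f g i (j + 1) - flux_y f g i j) / (2 * h)"
  by (simp add: Dy_def flux_y_def flip: add_divide_distrib) (simp add: algebra_simps)

text \<open>A difference of squares factors through the average. This is why the scheme evaluates
  its right-hand sides at the time midpoint: the energy change is then exact, with no error in
  \<open>dt\<close>.\<close>

lemma half_norm_square_diff:
  fixes x y :: "'a::real_inner"
  shows "1/2 * (norm y)\<^sup>2 - 1/2 * (norm x)\<^sup>2 = (y - x) \<bullet> ((1/2) *\<^sub>R (x + y))"
  by (simp add: power2_norm_eq_inner inner_diff_left inner_add_right inner_commute algebra_simps)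

text \<open>\<open>Omega_mid\<close> is the electric field \<open>- v \<times> B\<close>, so this is
  \<open>dt / dx\<close> times the x-component of \<open>b \<times> \<Omega>\<close>, averaged over
  the face: the Poynting flux with reversed sign, counting energy that enters from the
  right.\<close>

definition energy_flux_x ::
  "real \<Rightarrow> real \<Rightarrow> (nat \<Rightarrow> (real^3) grid) \<Rightarrow> (nat \<Rightarrow> (real^3) grid) \<Rightarrow> nat \<Rightarrow> real grid" where
  "energy_flux_x dx dt B v n i j = dt / (2 * dx) *
     (flux_x (component (midpoint B n) 2) (component (Omega_mid B v n) 3) i j
      - flux_x (component (midpoint B n) 3) (component (Omega_mid B v n) 2) i j)"

definition energy_flux_y ::
  "real \<Rightarrow> real \<Rightarrow> (nat \<Rightarrow> (real^3) grid) \<Rightarrow> (nat \<Rightarrow> (real^3) grid) \<Rightarrow> nat \<Rightarrow> real grid" where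
  "energy_flux_y dy dt B v n i j = dt / (2 * dy) *
     (flux_y (component (midpoint B n) 3) (component (Omega_mid B v n) 1) i j
      - flux_y (component (midpoint B n) 1) (component (Omega_mid B v n) 3) i j)"

text \<open>The kinetic change is \<open>dt * (curl b \<bullet> \<Omega>)\<close> and the magnetic
  one is \<open>- dt * (b \<bullet> curl \<Omega>)\<close>, with this minus sign. Their sum is
  \<open>dt\<close> times the discrete divergence of \<open>b \<times> \<Omega>\<close>.\<close>

lemma local_energy_balance:
  assumes "CT_step dx dy dt \<rho> B v n"
  shows "cell_energy \<rho> B v (Suc n) i j - cell_energy \<rho> B v n i j =
           (energy_flux_x dx dt B v n (i + 1) j - energy_flux_x dx dt B v n i j)
         + (energy_flux_y dy dt B v n i (j + 1) - energy_flux_y dy dt B v n i j)"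
proof -
  define b where "b = midpoint B n"
  define u where "u = midpoint v n"
  define W where "W = Omega_mid B v n"
  define c where "c = grid_curl dx dy b i j"
  have \<rho>: "\<rho> (Suc n) i j = \<rho> n i j"
    and B1: "B (Suc n) i j $ 1 - B n i j $ 1 = - dt * Dy dy (component W 3) i j"
    and B2: "B (Suc n) i j $ 2 - B n i j $ 2 = dt * Dx dx (component W 3) i j"
    and B3: "B (Suc n) i j $ 3 - B n i j $ 3 =
               dt * (Dy dy (component W 1) i j - Dx dx (component W 2) i j)"
    and v: "\<rho> n i j *\<^sub>R v (Suc n) i j = \<rho> n i j *\<^sub>R v n i j - dt *\<^sub>R cross3 (b i j) c"
    using assms unfolding CT_step_def b_def W_def c_def by (simp_all add: algebra_simps)
  have triple: "cross3 (b i j) c \<bullet> u i j = - (c \<bullet> W i j)"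
    by (simp add: W_def Omega_mid_def b_def u_def cross3_simps)
  have "1/2 * \<rho> n i j * (norm (v (Suc n) i j))\<^sup>2 - 1/2 * \<rho> n i j * (norm (v n i j))\<^sup>2
        = \<rho> n i j * (1/2 * (norm (v (Suc n) i j))\<^sup>2 - 1/2 * (norm (v n i j))\<^sup>2)"
    by (simp add: algebra_simps)
  also have "\<dots> = (\<rho> n i j *\<^sub>R (v (Suc n) i j - v n i j)) \<bullet> u i j"
    by (simp only: half_norm_square_diff u_def midpoint_def inner_scaleR_left)
  also have "\<rho> n i j *\<^sub>R (v (Suc n) i j - v n i j) = - dt *\<^sub>R cross3 (b i j) c"
    by (simp add: v scaleR_diff_right)
  also have "(- dt *\<^sub>R cross3 (b i j) c) \<bullet> u i j = dt * (c \<bullet> W i j)"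
    by (simp add: triple)
  finally have kinetic: "1/2 * \<rho> n i j * (norm (v (Suc n) i j))\<^sup>2
      - 1/2 * \<rho> n i j * (norm (v n i j))\<^sup>2 = dt * (c \<bullet> W i j)" .
  have magnetic: "1/2 * (norm (B (Suc n) i j))\<^sup>2 - 1/2 * (norm (B n i j))\<^sup>2
      = dt * (- Dy dy (component W 3) i j * b i j $ 1 + Dx dx (component W 3) i j * b i j $ 2
          + (Dy dy (component W 1) i j - Dx dx (component W 2) i j) * b i j $ 3)"
  proof -
    have "1/2 * (norm (B (Suc n) i j))\<^sup>2 - 1/2 * (norm (B n i j))\<^sup>2
        = (B (Suc n) i j - B n i j) \<bullet> b i j"
      by (simp only: half_norm_square_diff b_def midpoint_def)
    also have "\<dots> = (B (Suc n) i j $ 1 - B n i j $ 1) * b i j $ 1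
        + (B (Suc n) i j $ 2 - B n i j $ 2) * b i j $ 2
        + (B (Suc n) i j $ 3 - B n i j $ 3) * b i j $ 3"
      by (simp add: inner_vec_def sum_3)
    finally show ?thesis
      unfolding B1 B2 B3 by (simp add: algebra_simps)
  qed
  let ?f = "\<lambda>k. component b k" and ?g = "\<lambda>k. component W k"
  \<comment> \<open>Every derivative of \<open>b\<close> in \<open>c \<bullet> W i j\<close> meets,
    with the same sign, the derivative in the same direction of its partner in \<open>W\<close>; the
    four pairs are complete product rules.\<close>
  have "cell_energy \<rho> B v (Suc n) i j - cell_energy \<rho> B v n i j =
      dt * ((Dx dx (?f 2) i j * ?g 3 i j + ?f 2 i j * Dx dx (?g 3) i j)
          - (Dx dx (?f 3) i j * ?g 2 i j + ?f 3 i j * Dx dx (?g 2) i j))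
    + dt * ((Dy dy (?f 3) i j * ?g 1 i j + ?f 3 i j * Dy dy (?g 1) i j)
          - (Dy dy (?f 1) i j * ?g 3 i j + ?f 1 i j * Dy dy (?g 3) i j))"
  proof -
    have f: "?f k i j = b i j $ k" and g: "?g k i j = W i j $ k" for k
      by (simp_all add: component_def)
    have cW: "c \<bullet> W i j = Dy dy (?f 3) i j * W i j $ 1 - Dx dx (?f 3) i j * W i j $ 2
        + (Dx dx (?f 2) i j - Dy dy (?f 1) i j) * W i j $ 3"
      by (simp add: c_def grid_curl_def inner_vec_def sum_3)
    have "cell_energy \<rho> B v (Suc n) i j - cell_energy \<rho> B v n i j = dt * (c \<bullet> W i j)
      + dt * (- Dy dy (?g 3) i j * b i j $ 1 + Dx dx (?g 3) i j * b i j $ 2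
          + (Dy dy (?g 1) i j - Dx dx (?g 2) i j) * b i j $ 3)"
      unfolding cell_energy_def \<rho> using kinetic magnetic by linarith
    then show ?thesis
      unfolding cW f g by (simp add: algebra_simps)
  qed
  also have "\<dots> = (energy_flux_x dx dt B v n (i + 1) j - energy_flux_x dx dt B v n i j)
         + (energy_flux_y dy dt B v n i (j + 1) - energy_flux_y dy dt B v n i j)"
    unfolding Dx_product Dy_product energy_flux_x_def energy_flux_y_def b_def W_def
    by (simp add: diff_divide_distrib algebra_simps)
  finally show ?thesis .
qed

lemma sum_int_telescope:
  fixes F :: "int \<Rightarrow> 'a::ab_group_add"
  assumes "a \<le> b"
  shows "(\<Sum>i\<in>{a..<b}. F (i + 1) - F i) = F b - F a"
  using assms
proof (induction b rule: int_ge_induct)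
  case (step b)
  then have "{a..<b + 1} = insert b {a..<b}" by auto
  with step show ?case by simp
qed simp

text \<open>Both boundary conditions reduce to this form. A half-open box from \<open>a\<close> to
  \<open>a'\<close> has exactly the outer faces \<open>a\<close> and \<open>a'\<close>, so only
  fluxes through these survive the telescoping.\<close>

lemma box_energy_conservation:
  assumes CT: "CT_step dx dy dt \<rho> B v n"
    and le: "a \<le> a'" "b \<le> b'"
    and x: "\<And>j. energy_flux_x dx dt B v n a' j = energy_flux_x dx dt B v n a j"
    and y: "\<And>i. energy_flux_y dy dt B v n i b' = energy_flux_y dy dt B v n i b"
  shows "(\<Sum>(i, j) \<in> {a..<a'} \<times> {b..<b'}. cell_energy \<rho> B v n i j) =
         (\<Sum>(i, j) \<in> {a..<a'} \<times> {b..<b'}. cell_energy \<rho> B v (Suc n) i j)"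
proof -
  let ?X = "energy_flux_x dx dt B v n" and ?Y = "energy_flux_y dy dt B v n"
  have "(\<Sum>(i, j) \<in> {a..<a'} \<times> {b..<b'}. cell_energy \<rho> B v (Suc n) i j)
      - (\<Sum>(i, j) \<in> {a..<a'} \<times> {b..<b'}. cell_energy \<rho> B v n i j)
      = (\<Sum>i\<in>{a..<a'}. \<Sum>j\<in>{b..<b'}. (?X (i + 1) j - ?X i j) + (?Y i (j + 1) - ?Y i j))"
    by (simp add: local_energy_balance[OF CT] flip: sum.cartesian_product sum_subtractf)
  also have "\<dots> = (\<Sum>j\<in>{b..<b'}. \<Sum>i\<in>{a..<a'}. ?X (i + 1) j - ?X i j)
      + (\<Sum>i\<in>{a..<a'}. \<Sum>j\<in>{b..<b'}. ?Y i (j + 1) - ?Y i j)"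
    by (subst (2) sum.swap) (simp only: sum.distrib)
  also have "\<dots> = 0"
    using sum_int_telescope[OF le(1), of "\<lambda>i. ?X i _"] sum_int_telescope[OF le(2), of "?Y _"]
    by (simp add: x y)
  finally show ?thesis by simp
qed

lemma finite_int_pairs_subset_box:
  fixes S :: "(int \<times> int) set"
  assumes "finite S"
  obtains N where "0 \<le> N" "S \<subseteq> {- N<..<N} \<times> {- N<..<N}"
proof -
  from assms have "\<exists>N\<ge>0. S \<subseteq> {- N<..<N} \<times> {- N<..<N}"
  proof induction
    case (insert p S)
    then obtain N where "0 \<le> N" "S \<subseteq> {- N<..<N} \<times> {- N<..<N}" by blast
    then show ?case
      \<comment> \<open>The increment puts both coordinates of the new point strictly inside and
        keeps the old box inside.\<close>
      by (intro exI[of _ "N + \<bar>fst p\<bar> + \<bar>snd p\<bar> + 1"]) (cases p, force)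
  qed auto
  with that show thesis by blast
qed

theorem theorem3p12:
  fixes dx dy dt :: real
    and \<rho> :: "nat \<Rightarrow> real grid"
    and B v :: "nat \<Rightarrow> (real^3) grid"
    and n :: nat
  assumes "dx > 0" and "dy > 0" and "dt > 0"
    and "\<forall>i j. \<rho> n i j > 0"
    and "CT_step dx dy dt \<rho> B v n"
  shows "(\<forall>(Nx::int) (Ny::int) (a::int) (b::int).
            Nx > 0 \<longrightarrow> Ny > 0 \<longrightarrow>
            (\<forall>m \<in> {n, Suc n}. periodic_grid Nx Ny (\<rho> m) \<and> periodic_grid Nx Ny (B m)
                              \<and> periodic_grid Nx Ny (v m)) \<longrightarrow>
            (\<Sum>(i, j) \<in> {a..<a + Nx} \<times> {b..<b + Ny}. cell_energy \<rho> B v n i j) =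
            (\<Sum>(i, j) \<in> {a..<a + Nx} \<times> {b..<b + Ny}. cell_energy \<rho> B v (Suc n) i j))
       \<and> ((\<forall>m \<in> {n, Suc n}. compact_support_grid (B m) \<and> compact_support_grid (v m)) \<longrightarrow>
            (\<Sum>\<^sub>\<infinity>(i, j) \<in> UNIV. cell_energy \<rho> B v n i j) =
            (\<Sum>\<^sub>\<infinity>(i, j) \<in> UNIV. cell_energy \<rho> B v (Suc n) i j))"
proof (intro conjI allI impI)
  fix Nx Ny a b :: int
  assume pos: "0 < Nx" "0 < Ny"
    and per: "\<forall>m \<in> {n, Suc n}. periodic_grid Nx Ny (\<rho> m) \<and> periodic_grid Nx Ny (B m)
                \<and> periodic_grid Nx Ny (v m)"
  \<comment> \<open>The flux through face \<open>a + Nx\<close> reads the columns on both sides of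
    it, hence the versions with \<open>- 1\<close>.\<close>
  have shift: "F m (a + Nx) j = F m a j" "F m (a + Nx - 1) j = F m (a - 1) j"
      "F m i (b + Ny) = F m i b" "F m i (b + Ny - 1) = F m i (b - 1)"
    if "m \<in> {n, Suc n}" "F = B \<or> F = v" for F m i j
  proof -
    have p: "F m (i + Nx) j = F m i j" "F m i (j + Ny) = F m i j" for i j
      using per that unfolding periodic_grid_def by blast+
    show "F m (a + Nx) j = F m a j" "F m (a + Nx - 1) j = F m (a - 1) j"
      "F m i (b + Ny) = F m i b" "F m i (b + Ny - 1) = F m i (b - 1)"
      using p(1)[of a j] p(1)[of "a - 1" j] p(2)[of i b] p(2)[of i "b - 1"]
      by (simp_all add: algebra_simps)
  qed
  show "(\<Sum>(i, j) \<in> {a..<a + Nx} \<times> {b..<b + Ny}. cell_energy \<rho> B v n i j) =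
        (\<Sum>(i, j) \<in> {a..<a + Nx} \<times> {b..<b + Ny}. cell_energy \<rho> B v (Suc n) i j)"
    using pos
    by (intro box_energy_conservation[OF assms(5)])
       (simp_all add: energy_flux_x_def energy_flux_y_def flux_x_def flux_y_def component_def
          Omega_mid_def midpoint_def shift)
next
  assume cs: "\<forall>m \<in> {n, Suc n}. compact_support_grid (B m) \<and> compact_support_grid (v m)"
  \<comment> \<open>Both time levels enter, since the fluxes are built from midpoint values.\<close>
  define S where "S = (\<Union>m\<in>{n, Suc n}. {(i, j). B m i j \<noteq> 0} \<union> {(i, j). v m i j \<noteq> 0})"
  have "finite S"
    using cs unfolding S_def compact_support_grid_def by blast
  then obtain N where N: "0 \<le> N" "S \<subseteq> {- N<..<N} \<times> {- N<..<N}"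
    by (rule finite_int_pairs_subset_box)
  have zero: "B m i j = 0" "v m i j = 0"
    if "m \<in> {n, Suc n}" "i \<notin> {- N<..<N} \<or> j \<notin> {- N<..<N}" for m i j
    using that N(2) unfolding S_def by blast+
  have box: "(\<Sum>\<^sub>\<infinity>(i, j) \<in> UNIV. cell_energy \<rho> B v m i j)
      = (\<Sum>(i, j) \<in> {- N..<N} \<times> {- N..<N}. cell_energy \<rho> B v m i j)" if "m \<in> {n, Suc n}" for m
  proof -
    \<comment> \<open>Outside the box both fields vanish, and the kinetic energy with them although
      the density need not. So the infinite sum is truly finite and not the default 0 of a divergent
      one.\<close>
    have "(\<Sum>\<^sub>\<infinity>(i, j) \<in> UNIV. cell_energy \<rho> B v m i j)
        = (\<Sum>\<^sub>\<infinity>(i, j) \<in> {- N..<N} \<times> {- N..<N}. cell_energy \<rho> B v m i j)"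
    proof (rule infsum_cong_neutral)
      fix p assume "p \<in> UNIV - {- N..<N} \<times> {- N..<N}"
      then show "(case p of (i, j) \<Rightarrow> cell_energy \<rho> B v m i j) = 0"
        using zero[OF that, of "fst p" "snd p"] by (cases p) (auto simp: cell_energy_def)
    qed auto
    then show ?thesis by simp
  qed
  \<comment> \<open>The support lies in the open box, so rows and columns \<open>N\<close> and
    \<open>- N\<close> vanish. Column \<open>N - 1\<close> may not, but each product in the flux
    through face \<open>N\<close> has a factor from column \<open>N\<close>; likewise for
    rows.\<close>
  have "(\<Sum>(i, j) \<in> {- N..<N} \<times> {- N..<N}. cell_energy \<rho> B v n i j) =
        (\<Sum>(i, j) \<in> {- N..<N} \<times> {- N..<N}. cell_energy \<rho> B v (Suc n) i j)"
    using N(1)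
    by (intro box_energy_conservation[OF assms(5)])
       (simp_all add: energy_flux_x_def energy_flux_y_def flux_x_def flux_y_def component_def
          Omega_mid_def midpoint_def zero cross3_def)
  then show "(\<Sum>\<^sub>\<infinity>(i, j) \<in> UNIV. cell_energy \<rho> B v n i j) =
        (\<Sum>\<^sub>\<infinity>(i, j) \<in> UNIV. cell_energy \<rho> B v (Suc n) i j)"
    by (simp add: box)
qed

end
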